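(* Let $\psi$ be an entire function and let $\varphi(z)=az+b$, where $a,b\in\mathbb{C}$ and $0<|a|<1$. Assume that the weighted composition operator $C_{\psi,\varphi}$ is bounded on the Fock space $\mathcal{F}^2$. Suppose that $\psi(p)\neq 0$, where $p=\frac{b}{1-a}$ is the fixed point of $\varphi$. Let $q(z)=e^{\overline{p}(a-1)z}\psi(z+p)$, which belongs to $\mathcal{F}^2$, and write $q(z)=\sum_{j=0}^{\infty}\widehat{q}_j\frac{z^j}{\sqrt{j!}}$. Let $n$ be a non-negative integer and $m$ a positive integer. Then the numerical range $W(C_{\psi,\varphi})$ contains the ellipse with foci at $a^{n}$ and $a^{n+m}$, with major axis $$\sqrt{|a^{n}-a^{n+m}|^{2}+\frac{|\widehat{q}_{m}a^{n}\sqrt{(m+n)!}|^{2}}{m!\,n!}}$$ and minor axis $$\frac{|\widehat{q}_{m}a^{n}|\sqrt{(m+n)!}}{\sqrt{m!\,n!}}.$$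
   Context: The Fock space $\mathcal{F}^2$ is the Hilbert space of all entire functions $f:\mathbb{C}\to\mathbb{C}$ that are square integrable with respect to $d\mu(z)=\pi^{-1}e^{-|z|^2}\,dA(z)$, where $dA$ is Lebesgue measure on $\mathbb{C}$, with inner product $\langle f,g\rangle=\int_{\mathbb{C}}f\overline{g}\,d\mu$. The functions $z^j/\sqrt{j!}$, $j\ge 0$, form an orthonormal basis. For entire functions $\psi,\varphi$, the weighted composition operator is $C_{\psi,\varphi}h=\psi\cdot(h\circ\varphi)$. The numerical range of a bounded operator $T$ on a Hilbert space is $W(T)=\{\langle Tf,f\rangle:\|f\|=1\}$. The ellipse arises as the numerical range of a $2\times 2$ matrix (a compression of an operator unitarily equivalent to $C_{\psi,\varphi}$); the axes are given as full lengths.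
   Formalization: The foci are ψ(p)a^n and ψ(p)a^{n+m} instead of a^n and a^{n+m}, and the major axis uses |ψ(p)a^n − ψ(p)a^{n+m}|; as printed the claim fails (e.g. ψ = 1/2, b = 0, n = 0) and it agrees with this one when ψ(p) = 1. *)

theory Defs
  imports "HOL-Complex_Analysis.Complex_Analysis"
begin

definition fock_measure :: "complex measure" where
  "fock_measure = density lborel (\<lambda>z. ennreal (exp (- (cmod z)\<^sup>2) / pi))"

definition fock_space :: "(complex \<Rightarrow> complex) set" where
  "fock_space = {f. f holomorphic_on UNIV \<and> integrable fock_measure (\<lambda>z. (cmod (f z))\<^sup>2)}"

definition fock_inner :: "(complex \<Rightarrow> complex) \<Rightarrow> (complex \<Rightarrow> complex) \<Rightarrow> complex" where
  "fock_inner f g = (LINT z|fock_measure. f z * cnj (g z))"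

text \<open>
  The inner product of a function in the Fock space with itself is real and nonnegative,
  so taking the real part loses nothing.
\<close>
definition fock_norm :: "(complex \<Rightarrow> complex) \<Rightarrow> real" where
  "fock_norm f = sqrt (Re (fock_inner f f))"

definition weighted_comp ::
  "(complex \<Rightarrow> complex) \<Rightarrow> (complex \<Rightarrow> complex) \<Rightarrow> (complex \<Rightarrow> complex) \<Rightarrow> complex \<Rightarrow> complex" where
  "weighted_comp \<psi> \<phi> h = (\<lambda>z. \<psi> z * h (\<phi> z))"

text \<open>
  Linearity is not part of this predicate; weighted composition operators are linear by
  their form.
\<close>
definition fock_bounded :: "((complex \<Rightarrow> complex) \<Rightarrow> complex \<Rightarrow> complex) \<Rightarrow> bool" where
  "fock_bounded T \<longleftrightarrow>
     (\<forall>f\<in>fock_space. T f \<in> fock_space) \<and>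
     (\<exists>K. \<forall>f\<in>fock_space. fock_norm (T f) \<le> K * fock_norm f)"

definition fock_numerical_range ::
  "((complex \<Rightarrow> complex) \<Rightarrow> complex \<Rightarrow> complex) \<Rightarrow> complex set" where
  "fock_numerical_range T = {fock_inner (T f) f | f. f \<in> fock_space \<and> fock_norm f = 1}"

text \<open>
  The closed region bounded by the ellipse with foci \<open>u\<close>, \<open>v\<close> and major axis of full
  length \<open>l\<close>, as it occurs as the numerical range of a two-by-two matrix.  For
  \<open>l = dist u v\<close> it degenerates to the segment from \<open>u\<close> to \<open>v\<close>.
\<close>
definition elliptical_disc :: "complex \<Rightarrow> complex \<Rightarrow> real \<Rightarrow> complex set" where
  "elliptical_disc u v l = {w. dist w u + dist w v \<le> l}"

text \<open>
  The full length of the minor axis of that ellipse: an endpoint of the minor axis has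
  distance \<open>l / 2\<close> to each focus and the foci have distance \<open>dist u v / 2\<close> to the centre,
  so half the minor axis is a leg of a right triangle.
\<close>
definition minor_axis :: "complex \<Rightarrow> complex \<Rightarrow> real \<Rightarrow> real" where
  "minor_axis u v l = sqrt (l\<^sup>2 - (dist u v)\<^sup>2)"

end

theory Submission
  imports Defs "HOL-Probability.Distributions"
begin

text \<open>
  The Weyl operator \<open>U = fock_shift p\<close> is unitary and conjugates the weighted composition
  operator to \<open>S f = (\<lambda>z. q z * f (a * z))\<close>, whose composition part fixes \<open>0\<close>.  In particular
  \<open>q = S 1\<close> lies in the Fock space.  Writing \<open>e j = z ^ j / sqrt (fact j)\<close>, the compression of \<open>S\<close>
  to the span of \<open>e n\<close> and \<open>e (n + m)\<close> is triangular: its diagonal consists of the two foci, and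
  its off-diagonal entry \<open>c\<close> is read off the Taylor coefficients of \<open>S (e n)\<close>.  The values
  of this compression at unit vectors fill the elliptical disc.  The inner product with
  \<open>z ^ k\<close> extracts Taylor coefficients because the Gaussian measure is invariant under rotations.
\<close>

subsection \<open>Lebesgue measure on the complex plane\<close>

text \<open>Lebesgue measure is determined by its values on boxes, so \<open>lborel\<close> is the
  image of the product measure under \<open>C\<close>. Tonelli then gives both orders of
  integration.\<close>

lemma nn_integral_lborel_complex:
  assumes f: "f \<in> borel_measurable (borel :: complex measure)"
  shows "(\<integral>\<^sup>+ z. f z \<partial>lborel) = (\<integral>\<^sup>+ x. \<integral>\<^sup>+ y. f (Complex x y) \<partial>lborel \<partial>lborel)"
    and "(\<integral>\<^sup>+ z. f z \<partial>lborel) = (\<integral>\<^sup>+ y. \<integral>\<^sup>+ x. f (Complex x y) \<partial>lborel \<partial>lborel)"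
proof -
  define C where "C = (\<lambda>(x, y). Complex x y)"
  have C: "C \<in> lborel \<Otimes>\<^sub>M lborel \<rightarrow>\<^sub>M borel"
    unfolding C_def Complex_eq by (simp add: split_beta)
  have "lborel = distr (lborel \<Otimes>\<^sub>M lborel) borel C"
  proof (rule lborel_eqI)
    fix l u :: complex
    assume le: "\<And>b. b \<in> Basis \<Longrightarrow> l \<bullet> b \<le> u \<bullet> b"
    have *: "Re l \<le> Re u" "Im l \<le> Im u"
      using le[of 1] le[of \<i>] by (auto simp: Basis_complex_def inner_complex_def)
    have "C -` box l u \<inter> space (lborel \<Otimes>\<^sub>M lborel) = box (Re l) (Re u) \<times> box (Im l) (Im u)"
      by (auto simp: C_def in_box_complex_iff space_pair_measure)
    then have "emeasure (distr (lborel \<Otimes>\<^sub>M lborel) borel C) (box l u) =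
        ennreal (Re u - Re l) * ennreal (Im u - Im l)"
      using * by (simp add: emeasure_distr[OF C] lborel.emeasure_pair_measure_Times)
    also have "\<dots> = ennreal ((Re u - Re l) * (Im u - Im l))"
      using * by (simp add: ennreal_mult)
    finally show "emeasure (distr (lborel \<Otimes>\<^sub>M lborel) borel C) (box l u) =
        ennreal (\<Prod>b\<in>Basis. (u - l) \<bullet> b)"
      by (simp add: Basis_complex_def inner_complex_def)
  qed simp
  then have "(\<integral>\<^sup>+ z. f z \<partial>lborel) = (\<integral>\<^sup>+ z. f (C z) \<partial>(lborel \<Otimes>\<^sub>M lborel))"
    using nn_integral_distr[OF C, of f] f by simp
  moreover have m: "(\<lambda>z. f (C z)) \<in> borel_measurable (lborel \<Otimes>\<^sub>M lborel)"
    using measurable_compose[OF C f] .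
  ultimately show "(\<integral>\<^sup>+ z. f z \<partial>lborel) = (\<integral>\<^sup>+ x. \<integral>\<^sup>+ y. f (Complex x y) \<partial>lborel \<partial>lborel)"
    and "(\<integral>\<^sup>+ z. f z \<partial>lborel) = (\<integral>\<^sup>+ y. \<integral>\<^sup>+ x. f (Complex x y) \<partial>lborel \<partial>lborel)"
    using lborel.nn_integral_fst[OF m] lborel_pair.nn_integral_snd[OF m]
    by (simp_all add: C_def)
qed

lemma nn_integral_lborel_add:
  fixes f :: "'a::euclidean_space \<Rightarrow> ennreal"
  assumes "f \<in> borel_measurable borel"
  shows "(\<integral>\<^sup>+ x. f (c + x) \<partial>lborel) = (\<integral>\<^sup>+ x. f x \<partial>lborel)"
  using nn_integral_distr[of "(+) c" lborel borel f] assms by (simp add: lborel_distr_plus)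

text \<open>On each line parallel to its direction a shear acts as a translation, so translation
  invariance of the inner integral suffices.\<close>

lemma nn_integral_lborel_shear:
  fixes f :: "complex \<Rightarrow> ennreal" and t :: real
  assumes [measurable]: "f \<in> borel_measurable borel"
  shows "(\<integral>\<^sup>+ z. f (z + of_real (t * Im z)) \<partial>lborel) = (\<integral>\<^sup>+ z. f z \<partial>lborel)"
    and "(\<integral>\<^sup>+ z. f (z + \<i> * of_real (t * Re z)) \<partial>lborel) = (\<integral>\<^sup>+ z. f z \<partial>lborel)"
proof -
  have [measurable]: "(\<lambda>x. Complex x y) \<in> borel_measurable borel"
     "(\<lambda>x. Complex y x) \<in> borel_measurable borel" for y
    unfolding Complex_eq by simp_all
  have "(\<integral>\<^sup>+ z. f (z + of_real (t * Im z)) \<partial>lborel)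
      = (\<integral>\<^sup>+ y. \<integral>\<^sup>+ x. f (Complex x y + of_real (t * y)) \<partial>lborel \<partial>lborel)"
    by (subst nn_integral_lborel_complex(2)) simp_all
  also have "\<dots> = (\<integral>\<^sup>+ y. \<integral>\<^sup>+ x. f (Complex (t * y + x) y) \<partial>lborel \<partial>lborel)"
    by (simp add: Complex_eq algebra_simps)
  also have "\<dots> = (\<integral>\<^sup>+ y. \<integral>\<^sup>+ x. f (Complex x y) \<partial>lborel \<partial>lborel)"
    by (subst nn_integral_lborel_add[where f = "\<lambda>x. f (Complex x y)" for y]) simp_all
  finally show "(\<integral>\<^sup>+ z. f (z + of_real (t * Im z)) \<partial>lborel) = (\<integral>\<^sup>+ z. f z \<partial>lborel)"
    by (simp add: nn_integral_lborel_complex(2))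
  have "(\<integral>\<^sup>+ z. f (z + \<i> * of_real (t * Re z)) \<partial>lborel)
      = (\<integral>\<^sup>+ x. \<integral>\<^sup>+ y. f (Complex x y + \<i> * of_real (t * x)) \<partial>lborel \<partial>lborel)"
    by (subst nn_integral_lborel_complex(1)) simp_all
  also have "\<dots> = (\<integral>\<^sup>+ x. \<integral>\<^sup>+ y. f (Complex x (t * x + y)) \<partial>lborel \<partial>lborel)"
    by (simp add: Complex_eq algebra_simps)
  also have "\<dots> = (\<integral>\<^sup>+ x. \<integral>\<^sup>+ y. f (Complex x y) \<partial>lborel \<partial>lborel)"
    by (subst nn_integral_lborel_add[where f = "\<lambda>y. f (Complex x y)" for x]) simp_all
  finally show "(\<integral>\<^sup>+ z. f (z + \<i> * of_real (t * Re z)) \<partial>lborel) = (\<integral>\<^sup>+ z. f z \<partial>lborel)"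
    by (simp add: nn_integral_lborel_complex(1))
qed

lemma nn_integral_lborel_rotate:
  fixes f :: "complex \<Rightarrow> ennreal"
  assumes [measurable]: "f \<in> borel_measurable borel" and w: "cmod w = 1"
  shows "(\<integral>\<^sup>+ z. f (w * z) \<partial>lborel) = (\<integral>\<^sup>+ z. f z \<partial>lborel)"
proof -
  have non_real: "(\<integral>\<^sup>+ z. g (w * z) \<partial>lborel) = (\<integral>\<^sup>+ z. g z \<partial>lborel)"
    if w: "cmod w = 1" "Im w \<noteq> 0" and [measurable]: "g \<in> borel_measurable borel"
    for w and g :: "complex \<Rightarrow> ennreal"
  proof -
    \<comment> \<open>For \<open>w = cis \<theta>\<close> this is -tan(\<theta>/2), the slope of the
      two outer shears; the middle one has slope sin \<theta>.\<close>
    define r where "r = (Re w - 1) / Im w"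
    define X where "X z = z + complex_of_real (r * Im z)" for z
    define Y where "Y z = z + \<i> * complex_of_real (Im w * Re z)" for z
    have [measurable]: "X \<in> borel_measurable borel" "Y \<in> borel_measurable borel"
      unfolding X_def Y_def by simp_all
    have n: "(Re w)\<^sup>2 + (Im w)\<^sup>2 = 1"
      using w(1) by (metis cmod_power2 one_power2)
    \<comment> \<open>a rotation by a non-real \<open>w\<close> is the product of three shears\<close>
    have r: "r * Im w = Re w - 1" "r * (1 + Re w) = - Im w"
    proof -
      show "r * Im w = Re w - 1" using w(2) by (simp add: r_def)
      have "(Re w - 1) * (1 + Re w) = - Im w * Im w" using n by algebra
      then show "r * (1 + Re w) = - Im w" using w(2) by (simp add: r_def divide_eq_eq)
    qed
    have "X (Y (X z)) = w * z" for z
    proof -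
      have "Re w * Im z + Im w * Re z = Im z + Im w * (Re z + r * Im z)"
        using r(1) by algebra
      moreover have "Re w * Re z - Im w * Im z =
          Re z + r * Im z + r * (Im z + Im w * (Re z + r * Im z))"
        using r by algebra
      ultimately show ?thesis
        by (auto simp: X_def Y_def complex_eq_iff)
    qed
    then have "(\<integral>\<^sup>+ z. g (w * z) \<partial>lborel) = (\<integral>\<^sup>+ z. g (X (Y (X z))) \<partial>lborel)"
      by simp
    also have "\<dots> = (\<integral>\<^sup>+ z. g (X (Y z)) \<partial>lborel)"
      using nn_integral_lborel_shear(1)[of "\<lambda>z. g (X (Y z))" r, folded X_def] by simp
    also have "\<dots> = (\<integral>\<^sup>+ z. g (X z) \<partial>lborel)"
      using nn_integral_lborel_shear(2)[of "\<lambda>z. g (X z)" "Im w", folded Y_def] by simp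
    also have "\<dots> = (\<integral>\<^sup>+ z. g z \<partial>lborel)"
      using nn_integral_lborel_shear(1)[of g r, folded X_def] by simp
    finally show ?thesis .
  qed
  show ?thesis
  proof (cases "Im w = 0")
    case True
    \<comment> \<open>The slope \<open>r\<close> needs a non-real \<open>w\<close>. A real
      \<open>w\<close> is therefore split into the two non-real rotations \<open>\<i>\<close> and
      \<open>- \<i> * w\<close>.\<close>
    define v where "v = - \<i> * w"
    have v: "Im v \<noteq> 0" "cmod v = 1" "w = \<i> * v"
      using w True unfolding v_def by (auto simp: norm_mult cmod_def)
    have "(\<integral>\<^sup>+ z. f (w * z) \<partial>lborel) = (\<integral>\<^sup>+ z. f (\<i> * z) \<partial>lborel)"
      using non_real[OF v(2,1), of "\<lambda>z. f (\<i> * z)"] by (simp add: v(3) mult.assoc)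
    then show ?thesis using non_real[of \<i> f] by simp
  qed (use non_real w in simp)
qed

text \<open>The sign makes the preimages of the rays \<open>{x<..}\<close> discs, hence of finite measure.\<close>
lemma distr_neg_cmod_square:
  "distr lborel borel (\<lambda>z. - (cmod z)\<^sup>2) = density lborel (\<lambda>t. ennreal (pi * indicator {..0} t))"
proof (rule measure_eqI_lessThan)
  fix x :: real
  let ?M = "distr lborel borel (\<lambda>z. - (cmod z)\<^sup>2)"
  let ?N = "density lborel (\<lambda>t. ennreal (pi * indicator {..0} t))"
  \<comment> \<open>Valid for every sign of \<open>x\<close>: \<open>sqrt\<close> is odd, so for
    positive \<open>x\<close> the radius is negative and both sides are empty.\<close>
  have "{z. x < - (cmod z)\<^sup>2} = ball 0 (sqrt (-x))"
  proof -
    have "x < - (cmod z)\<^sup>2 \<longleftrightarrow> cmod z < sqrt (-x)" for z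
      using real_less_rsqrt[of "cmod z" "-x"] real_sqrt_less_iff[of "(cmod z)\<^sup>2" "-x"]
       by (simp del: real_sqrt_less_iff) linarith
    then show ?thesis by (intro set_eqI) (simp only: mem_Collect_eq mem_ball dist_0_norm)
  qed
  then have M: "emeasure ?M {x<..} = emeasure lborel (ball (0::complex) (sqrt (-x)))"
    by (subst emeasure_distr) (auto simp: greaterThan_def vimage_def)
  have M': "emeasure ?M {x<..} = ennreal (pi * max 0 (-x))"
  proof (cases "x \<le> 0")
    case True
    then show ?thesis by (simp add: M emeasure_ball eval_unit_ball_vol)
  next
    case False
    then have "ball (0::complex) (sqrt (-x)) = {}" by (simp only: ball_eq_empty) simp
    with M show ?thesis using False by (simp only: emeasure_empty) (simp add: max_def)
  qed
  then show "emeasure ?M {x<..} < \<infinity>" by simp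
  have "emeasure ?N {x<..} = (\<integral>\<^sup>+ t. ennreal pi * indicator {x<..0} t \<partial>lborel)"
    by (subst emeasure_density) (auto intro!: nn_integral_cong split: split_indicator)
  also have "\<dots> = ennreal (pi * max 0 (-x))"
    by (subst nn_integral_cmult_indicator) (auto simp: ennreal_mult max_def)
  finally show "emeasure ?M {x<..} = emeasure ?N {x<..}" using M' by simp
qed simp_all

subsection \<open>The Fock space and Taylor coefficients\<close>

lemma space_fock_measure [simp]: "space fock_measure = UNIV"
  and sets_fock_measure [simp, measurable_cong]: "sets fock_measure = sets borel"
  by (simp_all add: fock_measure_def)

lemma nn_integral_fock:
  assumes "f \<in> borel_measurable borel"
  shows "(\<integral>\<^sup>+ z. f z \<partial>fock_measure) = (\<integral>\<^sup>+ z. ennreal (exp (- (cmod z)\<^sup>2) / pi) * f z \<partial>lborel)"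
  unfolding fock_measure_def using assms by (subst nn_integral_density) simp_all

lemma integral_fock:
  fixes f :: "complex \<Rightarrow> 'a :: {banach, second_countable_topology}"
  assumes "f \<in> borel_measurable borel"
  shows "(LINT z|fock_measure. f z) = (LINT z|lborel. (exp (- (cmod z)\<^sup>2) / pi) *\<^sub>R f z)"
    and "integrable fock_measure f \<longleftrightarrow> integrable lborel (\<lambda>z. (exp (- (cmod z)\<^sup>2) / pi) *\<^sub>R f z)"
  unfolding fock_measure_def using assms by (simp_all add: integral_density integrable_density)

text \<open>The density depends on \<open>cmod z\<close> only, so rotation invariance passes from
  \<open>lborel\<close> to the Gaussian measure.\<close>

lemma distr_fock_rotate:
  assumes "cmod w = 1"
  shows "distr fock_measure borel ((*) w) = fock_measure"
proof (rule measure_eqI)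
  fix A assume "A \<in> sets (distr fock_measure borel ((*) w))"
  then have A[measurable]: "A \<in> sets borel" by simp
  have "emeasure (distr fock_measure borel ((*) w)) A = (\<integral>\<^sup>+ z. indicator A (w * z) \<partial>fock_measure)"
    by (subst nn_integral_indicator[symmetric], simp, subst nn_integral_distr) simp_all
  also have "\<dots> = (\<integral>\<^sup>+ z. ennreal (exp (- (cmod (w * z))\<^sup>2) / pi) * indicator A (w * z) \<partial>lborel)"
    by (subst nn_integral_fock) (simp_all add: norm_mult assms)
  also have "\<dots> = (\<integral>\<^sup>+ z. indicator A z \<partial>fock_measure)"
    using nn_integral_lborel_rotate[OF _ assms,
        of "\<lambda>z. ennreal (exp (- (cmod z)\<^sup>2) / pi) * indicator A z"]
    by (subst nn_integral_fock) simp_all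
  finally show "emeasure (distr fock_measure borel ((*) w)) A = emeasure fock_measure A" by simp
qed simp

lemma integral_fock_rotate:
  fixes f :: "complex \<Rightarrow> complex"
  assumes "cmod w = 1" and "f \<in> borel_measurable borel"
  shows "(LINT z|fock_measure. f (w * z)) = (LINT z|fock_measure. f z)"
  using integral_distr[of "(*) w" fock_measure borel f] distr_fock_rotate[OF assms(1)] assms(2)
  by simp

text \<open>Pushing forward along the negated squared modulus cancels the factor 1/pi, and a
  reflection leaves the Gamma integral of \<open>t ^ k * exp (- t)\<close> over the
  half-line.\<close>

lemma nn_integral_fock_power:
  "(\<integral>\<^sup>+ z. ennreal (cmod z ^ (2 * k)) \<partial>fock_measure) = ennreal (fact k)"
proof -
  let ?h = "\<lambda>t::real. ennreal (exp t / pi * (- t) ^ k)"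
  have "(\<integral>\<^sup>+ z. ennreal (cmod z ^ (2 * k)) \<partial>fock_measure)
      = (\<integral>\<^sup>+ z. ?h (- (cmod z)\<^sup>2) \<partial>lborel)"
    by (subst nn_integral_fock)
      (auto simp: ennreal_mult'[symmetric] power_mult intro!: nn_integral_cong)
  also have "\<dots> = (\<integral>\<^sup>+ t. ?h t \<partial>distr lborel borel (\<lambda>z. - (cmod z)\<^sup>2))"
    by (subst nn_integral_distr) simp_all
  also have "\<dots> = (\<integral>\<^sup>+ t. ennreal (pi * indicator {..0} t) * ?h t \<partial>lborel)"
    unfolding distr_neg_cmod_square by (subst nn_integral_density) simp_all
  also have "\<dots> = (\<integral>\<^sup>+ t. ennreal (pi * indicator {..0} (- t)) * ?h (- t) \<partial>lborel)"
    using nn_integral_real_affine[of "\<lambda>t. ennreal (pi * indicator {..0} t) * ?h t" "-1" 0] by simp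
  also have "\<dots> = (\<integral>\<^sup>+ t. ennreal (t ^ k * exp (- t)) * indicator {0..} t \<partial>lborel)"
    by (intro nn_integral_cong)
      (auto simp: ennreal_mult'[symmetric] split: split_indicator)
  also have "\<dots> = ennreal (fact k)"
    using nn_intergal_power_times_exp_Ici[of k] by simp
  finally show ?thesis .
qed

lemma integrable_fock_power: "integrable fock_measure (\<lambda>z. cmod z ^ (2 * k))"
  and integral_fock_power: "(LINT z|fock_measure. cmod z ^ (2 * k)) = fact k"
proof -
  show "integrable fock_measure (\<lambda>z. cmod z ^ (2 * k))"
    by (rule integrableI_bounded) (simp_all add: nn_integral_fock_power)
  then show "(LINT z|fock_measure. cmod z ^ (2 * k)) = fact k"
    using nn_integral_eq_integral[of fock_measure "\<lambda>z. cmod z ^ (2 * k)"]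
    by (simp add: nn_integral_fock_power)
qed

lemma finite_measure_fock: "finite_measure fock_measure"
  by (rule finite_measureI) (use nn_integral_fock_power[of 0] in simp)

section \<open>Integrability and membership in the Fock space\<close>

lemma borel_measurable_cnj [measurable]: "cnj \<in> borel_measurable borel"
  by (intro borel_measurable_continuous_onI continuous_intros)

lemma fock_spaceD:
  assumes "f \<in> fock_space"
  shows "f holomorphic_on UNIV" "integrable fock_measure (\<lambda>z. (cmod (f z))\<^sup>2)"
    and "f \<in> borel_measurable borel"
  using assms
  by (auto simp: fock_space_def intro!: borel_measurable_continuous_onI holomorphic_on_imp_continuous_on)

lemma fock_space_integrable_mult:
  assumes f: "f \<in> fock_space" and g: "g \<in> fock_space"
  shows "integrable fock_measure (\<lambda>z. f z * cnj (g z))"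
proof (rule Bochner_Integration.integrable_bound)
  show "integrable fock_measure (\<lambda>z. (cmod (f z))\<^sup>2 + (cmod (g z))\<^sup>2)"
    using fock_spaceD(2)[OF f] fock_spaceD(2)[OF g] by simp
  show "(\<lambda>z. f z * cnj (g z)) \<in> borel_measurable fock_measure"
    using fock_spaceD(3)[OF f] fock_spaceD(3)[OF g] by measurable
  have "cmod (f z * cnj (g z)) \<le> (cmod (f z))\<^sup>2 + (cmod (g z))\<^sup>2" for z
  proof -
    have "0 \<le> cmod (f z) * cmod (g z)" by simp
    then show ?thesis
      using sum_squares_bound[of "cmod (f z)" "cmod (g z)"] unfolding norm_mult complex_mod_cnj
      by linarith
  qed
  then show "AE z in fock_measure. norm (f z * cnj (g z)) \<le> norm ((cmod (f z))\<^sup>2 + (cmod (g z))\<^sup>2)"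
    by (simp add: abs_of_nonneg)
qed

lemma fock_space_add:
  assumes f: "f \<in> fock_space" and g: "g \<in> fock_space"
  shows "(\<lambda>z. f z + g z) \<in> fock_space"
proof -
  have "integrable fock_measure (\<lambda>z. (cmod (f z + g z))\<^sup>2)"
  proof (rule Bochner_Integration.integrable_bound)
    show "integrable fock_measure (\<lambda>z. 2 * (cmod (f z))\<^sup>2 + 2 * (cmod (g z))\<^sup>2)"
      using fock_spaceD(2)[OF f] fock_spaceD(2)[OF g] by simp
    show "(\<lambda>z. (cmod (f z + g z))\<^sup>2) \<in> borel_measurable fock_measure"
      using fock_spaceD(3)[OF f] fock_spaceD(3)[OF g] by simp
    have "(cmod (f z + g z))\<^sup>2 \<le> 2 * (cmod (f z))\<^sup>2 + 2 * (cmod (g z))\<^sup>2" for z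
    proof -
      have "(cmod (f z + g z))\<^sup>2 \<le> (cmod (f z) + cmod (g z))\<^sup>2"
        by (intro power_mono norm_triangle_ineq) simp
      then show ?thesis
        using sum_squares_bound[of "cmod (f z)" "cmod (g z)"] by (simp add: power2_sum)
    qed
    then show "AE z in fock_measure. norm ((cmod (f z + g z))\<^sup>2)
        \<le> norm (2 * (cmod (f z))\<^sup>2 + 2 * (cmod (g z))\<^sup>2)"
      by (simp add: abs_of_nonneg)
  qed
  then show ?thesis
    using fock_spaceD(1)[OF f] fock_spaceD(1)[OF g]
    by (auto simp: fock_space_def intro: holomorphic_intros)
qed

lemma fock_space_monomial: "(\<lambda>z. c * z ^ k) \<in> fock_space"
  using integrable_fock_power[of k]
  by (auto simp: fock_space_def norm_mult norm_power power_mult_distrib power_mult[symmetric] mult.commute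
      intro!: holomorphic_intros)

section \<open>Inner products with monomials\<close>

text \<open>
  The disc is invariant under the rotation by \<open>w = cis (pi / (l - k))\<close>, which multiplies the
  integrand by \<open>w ^ (l - k) = -1\<close>.
\<close>
lemma fock_inner_disc_orthogonal:
  assumes "l \<noteq> k"
  shows "(LINT z|fock_measure. indicator (cball 0 R) z *\<^sub>R (z ^ l * cnj z ^ k)) = 0"
proof -
  \<comment> \<open>The subtraction is done in the reals, so both l < k and l > k lead to the angle
    pi.\<close>
  define t where "t = pi / (real l - real k)"
  define w where "w = cis t"
  define F where "F z = indicator (cball 0 R) z *\<^sub>R (z ^ l * cnj z ^ k)" for z :: complex
  have t: "real l * t - real k * t = pi"
    unfolding left_diff_distrib[symmetric] using assms by (simp add: t_def)
  have "w ^ l * cnj w ^ k = cis (real l * t - real k * t)"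
    by (simp add: w_def Complex.DeMoivre cis_cnj cis_mult)
  then have w: "w ^ l * cnj w ^ k = -1" by (simp add: t)
  have "F (w * z) = (w ^ l * cnj w ^ k) * F z" for z
    by (simp add: F_def w_def norm_mult indicator_def power_mult_distrib)
  then have "F (w * z) = - F z" for z by (simp add: w)
  moreover have "(LINT z|fock_measure. F (w * z)) = (LINT z|fock_measure. F z)"
  proof (rule integral_fock_rotate)
    have [measurable]: "cball 0 R \<in> sets (borel :: complex measure)" by simp
    show "F \<in> borel_measurable borel" unfolding F_def[abs_def] by measurable
  qed (simp add: w_def)
  ultimately show ?thesis by (simp add: F_def[symmetric])
qed

text \<open>On a disc the terms of the power series have the summable bound \<open>B\<close>, so the
  series may be integrated termwise. By orthogonality only the term l = k survives.\<close>

lemma fock_inner_disc: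
  fixes c :: "nat \<Rightarrow> complex"
  assumes c: "\<And>z. (\<lambda>j. c j * z ^ j) sums g z" and R: "R \<ge> 0"
  shows "(LINT z|fock_measure. indicator (cball 0 R) z *\<^sub>R (g z * cnj z ^ k))
    = c k * (LINT z|fock_measure. indicator (cball 0 R) z *\<^sub>R (z ^ k * cnj z ^ k))"
proof -
  interpret finite_measure fock_measure by (rule finite_measure_fock)
  define F where "F l z = indicator (cball 0 R) z *\<^sub>R (c l * (z ^ l * cnj z ^ k))" for l and z :: complex
  define B where "B l = cmod (c l * of_real R ^ l) * R ^ k" for l
  \<comment> \<open>Convergence at the point R + 1 forces absolute convergence at the smaller radius
    R.\<close>
  have B: "summable B"
    unfolding B_def
    by (intro summable_mult2 powser_insidea[of c "of_real (R + 1)"] sums_summable[OF c])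
      (use R in auto)
  have le: "cmod (F l z) \<le> B l" for l z
  proof (cases "z \<in> cball 0 R")
    case True
    then have "cmod (c l) * (cmod z ^ l * cmod z ^ k) \<le> cmod (c l) * (R ^ l * R ^ k)"
      using R by (intro mult_left_mono mult_mono power_mono) auto
    then show ?thesis using True R by (simp add: F_def B_def norm_mult norm_power mult.assoc)
  qed (use R in \<open>simp add: F_def B_def\<close>)
  have int: "integrable fock_measure (F l)" for l
  proof (rule integrable_const_bound)
    have [measurable]: "cball 0 R \<in> sets (borel :: complex measure)" by simp
    have "F l \<in> borel_measurable borel" unfolding F_def[abs_def] by measurable
    then show "F l \<in> borel_measurable fock_measure" by simp
    show "AE z in fock_measure. cmod (F l z) \<le> B l" using le by simp
  qed
  have "(\<lambda>l. LINT z|fock_measure. F l z) sums (LINT z|fock_measure. (\<Sum>l. F l z))"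
  proof (rule sums_integral[OF int])
    show "AE z in fock_measure. summable (\<lambda>l. norm (F l z))"
      using summable_comparison_test'[OF B, of 0 "\<lambda>l. cmod (F l z)" for z] le by auto
    have "norm (LINT z|fock_measure. norm (F l z)) \<le> B l * measure fock_measure UNIV" for l
      using integral_mono[OF integrable_norm[OF int[of l]], of "\<lambda>_. B l"] le by (simp add: mult.commute)
    then show "summable (\<lambda>l. LINT z|fock_measure. norm (F l z))"
      by (intro summable_comparison_test'[OF summable_mult2[OF B]])
  qed
  moreover have "(LINT z|fock_measure. F l z) =
      (if l = k then c k * (LINT z|fock_measure. indicator (cball 0 R) z *\<^sub>R (z ^ k * cnj z ^ k)) else 0)" for l
  proof -
    have "(LINT z|fock_measure. F l z)
        = c l * (LINT z|fock_measure. indicator (cball 0 R) z *\<^sub>R (z ^ l * cnj z ^ k))"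
      unfolding integral_mult_right_zero[symmetric] F_def by (simp add: mult_scaleR_right)
    then show ?thesis using fock_inner_disc_orthogonal[of l k R] by simp
  qed
  moreover have "(\<Sum>l. F l z) = indicator (cball 0 R) z *\<^sub>R (g z * cnj z ^ k)" for z
    unfolding F_def
    using sums_unique[OF sums_scaleR_right[OF sums_mult2[OF c[of z], of "cnj z ^ k"],
      of "indicator (cball 0 R) z"]]
    by (simp add: mult.assoc)
  ultimately have "(\<lambda>l. if l = k then c k * (LINT z|fock_measure. indicator (cball 0 R) z *\<^sub>R (z ^ k * cnj z ^ k)) else 0)
      sums (LINT z|fock_measure. indicator (cball 0 R) z *\<^sub>R (g z * cnj z ^ k))"
    by simp
  then show ?thesis
    by (rule sums_unique2) (rule sums_single)
qed

lemma fock_integral_discs_tendsto: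
  fixes h :: "complex \<Rightarrow> complex"
  assumes h: "integrable fock_measure h"
  shows "(\<lambda>n. LINT z|fock_measure. indicator (cball 0 (real n)) z *\<^sub>R h z) \<longlonglongrightarrow> (LINT z|fock_measure. h z)"
proof (rule integral_dominated_convergence)
  have h': "h \<in> borel_measurable fock_measure" using h by simp
  show "h \<in> borel_measurable fock_measure" by (rule h')
  show "integrable fock_measure (\<lambda>z. norm (h z))" using h by simp
  show "(\<lambda>z. indicator (cball 0 (real n)) z *\<^sub>R h z) \<in> borel_measurable fock_measure" for n
    by (intro borel_measurable_scaleR borel_measurable_indicator h') simp
  show "AE z in fock_measure. norm (indicator (cball 0 (real n)) z *\<^sub>R h z) \<le> norm (h z)" for n
    by (simp add: indicator_def)
  have "(\<lambda>n. indicator (cball 0 (real n)) z *\<^sub>R h z) \<longlonglongrightarrow> h z" for z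
  proof (rule tendsto_eventually)
    obtain N where "cmod z \<le> real N" using real_arch_simple by blast
    then have "cmod z \<le> real n" if "n \<ge> N" for n
      using that by (meson le_trans of_nat_mono order_trans)
    then show "\<forall>\<^sub>F n in sequentially. indicator (cball 0 (real n)) z *\<^sub>R h z = h z"
      by (intro eventually_sequentiallyI[of N]) (simp add: indicator_def)
  qed
  then show "AE z in fock_measure. (\<lambda>n. indicator (cball 0 (real n)) z *\<^sub>R h z) \<longlonglongrightarrow> h z"
    by simp
qed

text \<open>Let the radius tend to infinity in the disc formula: the left side tends to the inner
  product, the right side to \<open>c k\<close> times the squared norm \<open>fact k\<close> of the
  monomial.\<close>

lemma fock_inner_power:
  assumes g: "g \<in> fock_space" and c: "\<And>z. (\<lambda>j. c j * z ^ j) sums g z"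
  shows "fock_inner g (\<lambda>z. z ^ k) = c k * fact k"
proof -
  have e: "(\<lambda>z. z ^ k) \<in> fock_space" using fock_space_monomial[of 1 k] by simp
  have eq: "(\<lambda>z. z ^ k * cnj z ^ k) = (\<lambda>z. complex_of_real (cmod z ^ (2 * k)))"
    by (simp add: fun_eq_iff power_mult_distrib[symmetric] power_mult complex_norm_square[symmetric])
  have "(\<lambda>n. LINT z|fock_measure. indicator (cball 0 (real n)) z *\<^sub>R (g z * cnj z ^ k))
      \<longlonglongrightarrow> fock_inner g (\<lambda>z. z ^ k)"
    using fock_integral_discs_tendsto[OF fock_space_integrable_mult[OF g e]] by (simp add: fock_inner_def)
  moreover have "(\<lambda>n. c k * (LINT z|fock_measure. indicator (cball 0 (real n)) z *\<^sub>R (z ^ k * cnj z ^ k)))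
      \<longlonglongrightarrow> c k * fock_inner (\<lambda>z. z ^ k) (\<lambda>z. z ^ k)"
    using fock_integral_discs_tendsto[OF fock_space_integrable_mult[OF e e]]
    by (intro tendsto_mult_left) (simp add: fock_inner_def)
  moreover have "fock_inner (\<lambda>z. z ^ k) (\<lambda>z. z ^ k) = fact k"
    using integral_fock_power[of k] by (simp add: fock_inner_def eq del: of_real_power)
  ultimately show ?thesis
    using fock_inner_disc[OF c, of "real n" k for n] LIMSEQ_unique by auto
qed

lemma fock_inner_two_monomials:
  assumes g: "g \<in> fock_space" and c: "\<And>z. (\<lambda>j. c j * z ^ j) sums g z"
  shows "fock_inner g (\<lambda>z. s * z ^ k + t * z ^ l) = cnj s * (c k * fact k) + cnj t * (c l * fact l)"
proof -
  have e: "(\<lambda>z. z ^ k) \<in> fock_space" for k using fock_space_monomial[of 1 k] by simp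
  have "integrable fock_measure (\<lambda>z. cnj s * (g z * cnj (z ^ k)))" for s k
    by (intro integrable_mult_right fock_space_integrable_mult[OF g e])
  then show ?thesis
    using fock_inner_power[OF g c] by (simp add: fock_inner_def ring_distribs mult.left_commute)
qed

subsection \<open>Weyl operators\<close>

text \<open>The scalar \<open>exp (- (cmod p)\<^sup>2 / 2)\<close> makes these translations unitary.\<close>
definition fock_shift :: "complex \<Rightarrow> (complex \<Rightarrow> complex) \<Rightarrow> complex \<Rightarrow> complex" where
  "fock_shift p f = (\<lambda>z. exp (cnj p * z - of_real ((cmod p)\<^sup>2 / 2)) * f (z - p))"

text \<open>Serves to recover \<open>S f\<close> from \<open>fock_shift p (S f)\<close>, and with it
  membership of \<open>S f\<close> in the Fock space.\<close>

lemma fock_shift_cancel: "fock_shift (- p) (fock_shift p f) = f"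
proof
  fix z
  have "- (cnj p * z) - of_real ((cmod p)\<^sup>2 / 2) + (cnj p * (z + p) - of_real ((cmod p)\<^sup>2 / 2)) = 0"
    by (simp add: field_simps complex_norm_square[symmetric])
  then have "exp (- (cnj p * z) - of_real ((cmod p)\<^sup>2 / 2)) * exp (cnj p * (z + p) - of_real ((cmod p)\<^sup>2 / 2)) = 1"
    unfolding exp_add[symmetric] by simp
  then show "fock_shift (- p) (fock_shift p f) z = f z"
    by (simp add: fock_shift_def mult.assoc[symmetric])
qed

text \<open>Completing the square in the exponent: the weight of the Weyl operator turns the
  Gaussian into its translate by \<open>p\<close>.\<close>

lemma fock_shift_density:
  "exp (- (cmod z)\<^sup>2) * (cmod (exp (cnj p * z - of_real ((cmod p)\<^sup>2 / 2))))\<^sup>2 = exp (- (cmod (z - p))\<^sup>2)"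
proof -
  have "exp (- (cmod z)\<^sup>2) * (exp (Re (cnj p * z - of_real ((cmod p)\<^sup>2 / 2))))\<^sup>2
     = exp (- (cmod z)\<^sup>2 + 2 * Re (cnj p * z - of_real ((cmod p)\<^sup>2 / 2)))"
    by (simp only: exp_add exp_double)
  also have "- (cmod z)\<^sup>2 + 2 * Re (cnj p * z - of_real ((cmod p)\<^sup>2 / 2)) = - (cmod (z - p))\<^sup>2"
    unfolding cmod_power2 by (simp add: power2_eq_square algebra_simps)
  finally show ?thesis by simp
qed

text \<open>By the density identity this is translation invariance of \<open>lborel\<close>. The
  value type is general because real \<open>h\<close> gives membership and complex \<open>h\<close>
  gives inner products.\<close>

lemma fock_shift_integral:
  fixes h :: "complex \<Rightarrow> 'a::{banach, second_countable_topology}"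
  assumes [measurable]: "h \<in> borel_measurable borel"
  shows "(LINT z|fock_measure. (cmod (exp (cnj p * z - of_real ((cmod p)\<^sup>2 / 2))))\<^sup>2 *\<^sub>R h (z - p))
      = (LINT z|fock_measure. h z)" (is ?int)
    and "integrable fock_measure (\<lambda>z. (cmod (exp (cnj p * z - of_real ((cmod p)\<^sup>2 / 2))))\<^sup>2 *\<^sub>R h (z - p))
      \<longleftrightarrow> integrable fock_measure h" (is ?iff)
proof -
  define k where "k z = (exp (- (cmod z)\<^sup>2) / pi) *\<^sub>R h z" for z
  have k: "k \<in> borel_measurable borel" unfolding k_def[abs_def] by measurable
  have eq: "(exp (- (cmod z)\<^sup>2) / pi) *\<^sub>R (cmod (exp (cnj p * z - of_real ((cmod p)\<^sup>2 / 2))))\<^sup>2 *\<^sub>R h (z - p)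
      = k (- p + z)" for z
    using fock_shift_density[of z p] by (simp add: k_def)
  have sh: "(LINT z|lborel. k (- p + z)) = (LINT z|lborel. k z)"
    "integrable lborel (\<lambda>z. k (- p + z)) \<longleftrightarrow> integrable lborel k"
    using integral_distr[of "(+) (- p)" lborel borel k] integrable_distr_eq[of "(+) (- p)" lborel borel k] k
    unfolding lborel_distr_plus by simp_all
  have m: "(\<lambda>z. (cmod (exp (cnj p * z - of_real ((cmod p)\<^sup>2 / 2))))\<^sup>2 *\<^sub>R h (z - p)) \<in> borel_measurable borel"
  proof -
    have [measurable]: "(\<lambda>z. exp (cnj p * z - of_real ((cmod p)\<^sup>2 / 2))) \<in> borel_measurable borel"
      by (intro borel_measurable_continuous_onI continuous_intros)
    show ?thesis by measurable
  qed
  show ?int ?iff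
    unfolding integral_fock[OF m] integral_fock[OF assms] eq using sh by (simp_all add: k_def[abs_def])
qed

lemma fock_shift_in_fock_space:
  assumes "f \<in> fock_space"
  shows "fock_shift p f \<in> fock_space"
proof -
  note f = fock_spaceD[OF assms]
  have "integrable fock_measure (\<lambda>z. (cmod (fock_shift p f z))\<^sup>2)"
    using fock_shift_integral(2)[of "\<lambda>z. (cmod (f z))\<^sup>2" p] f(2,3)
    by (simp add: fock_shift_def norm_mult power_mult_distrib)
  moreover have "fock_shift p f holomorphic_on UNIV"
    unfolding fock_shift_def
    by (intro holomorphic_intros holomorphic_on_compose_gen[OF _ f(1), unfolded o_def]) auto
  ultimately show ?thesis by (simp add: fock_space_def)
qed

lemma fock_inner_shift:
  assumes f: "f \<in> fock_space" and g: "g \<in> fock_space"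
  shows "fock_inner (fock_shift p f) (fock_shift p g) = fock_inner f g"
proof -
  have *: "fock_shift p f z * cnj (fock_shift p g z) =
     (cmod (exp (cnj p * z - of_real ((cmod p)\<^sup>2 / 2))))\<^sup>2 *\<^sub>R (f (z - p) * cnj (g (z - p)))" for z
    unfolding fock_shift_def scaleR_conv_of_real complex_norm_square by (simp add: mult_ac)
  show ?thesis
    unfolding fock_inner_def *
    by (rule fock_shift_integral(1)) (use fock_spaceD(3)[OF f] fock_spaceD(3)[OF g] in measurable)
qed

subsection \<open>The elliptical range of a triangular matrix\<close>

text \<open>
  With \<open>|s|^2 = (1 + x) / 2\<close>, \<open>|t|^2 = (1 - x) / 2\<close> and \<open>s * cnj t = e / 2\<close> the claim reads
  \<open>y = x * d + c * e\<close> with \<open>|e|^2 = 1 - x^2\<close>, where \<open>d = u - v\<close> and \<open>y = 2 * w - u - v\<close>.  Such an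
  \<open>e\<close> exists iff the quadratic \<open>h\<close> below vanishes at \<open>x\<close>.  It is nonnegative at \<open>1\<close>, and the
  ellipse condition is exactly what makes its minimum, at \<open>x0\<close>, nonpositive.
\<close>
lemma elliptical_disc_parametrization:
  fixes u v c w :: complex
  assumes w: "w \<in> elliptical_disc u v (sqrt ((cmod (u - v))\<^sup>2 + (cmod c)\<^sup>2))"
  obtains s t where "(cmod s)\<^sup>2 + (cmod t)\<^sup>2 = 1"
    and "w = u * (of_real (cmod s))\<^sup>2 + v * (of_real (cmod t))\<^sup>2 + c * s * cnj t"
proof -
  define d where "d = u - v"
  define y where "y = 2 * w - u - v"
  define L where "L = sqrt ((cmod d)\<^sup>2 + (cmod c)\<^sup>2)"
  have L2: "L\<^sup>2 = (cmod d)\<^sup>2 + (cmod c)\<^sup>2" and L0: "L \<ge> 0" by (simp_all add: L_def)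
  define r where "r = Re (y * cnj d)"
  define h where "h x = (cmod (y - of_real x * d))\<^sup>2 - (cmod c)\<^sup>2 * (1 - x\<^sup>2)" for x :: real
  have h: "h x = L\<^sup>2 * x\<^sup>2 - 2 * x * r + ((cmod y)\<^sup>2 - (cmod c)\<^sup>2)" for x
    unfolding h_def L2 r_def cmod_power2 by (simp add: power2_eq_square algebra_simps)
  \<comment> \<open>Centred at the midpoint of the foci and doubled, the ellipse has foci
    \<open>d\<close> and \<open>- d\<close>, which gives the form \<open>foci\<close> of the
    condition.\<close>
  have yd: "y - d = 2 * (w - u)" "y + d = 2 * (w - v)" by (simp_all add: y_def d_def algebra_simps)
  have foci: "cmod (y - d) + cmod (y + d) \<le> 2 * L"
    unfolding yd norm_mult using w by (simp add: elliptical_disc_def dist_norm L_def d_def)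
  have y_le: "cmod y \<le> L"
  proof -
    have "2 * cmod y = cmod ((y - d) + (y + d))" by (simp add: norm_mult flip: mult_2)
    also have "\<dots> \<le> 2 * L" using foci norm_triangle_ineq[of "y - d" "y + d"] by linarith
    finally show ?thesis by simp
  qed
  have d_le: "cmod d \<le> L" unfolding L_def by (intro real_le_rsqrt) simp
  have r_le: "\<bar>r\<bar> \<le> L\<^sup>2"
  proof -
    have "\<bar>r\<bar> \<le> cmod y * cmod d"
      unfolding r_def using abs_Re_le_cmod[of "y * cnj d"] by (simp add: norm_mult)
    also have "\<dots> \<le> L * L" using y_le d_le L0 by (intro mult_mono) auto
    finally show ?thesis by (simp add: power2_eq_square)
  qed
  \<comment> \<open>The discriminant condition for \<open>h\<close>. Squaring \<open>foci\<close>
    and applying the parallelogram law bounds the product of the two distances; squaring once more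
    brings in \<open>r\<close>.\<close>
  have disc: "L\<^sup>2 * ((cmod y)\<^sup>2 - (cmod c)\<^sup>2) \<le> r\<^sup>2"
  proof -
    define A where "A = (cmod y)\<^sup>2 + (cmod d)\<^sup>2"
    have A: "(cmod (y - d))\<^sup>2 + (cmod (y + d))\<^sup>2 = 2 * A"
      unfolding A_def cmod_power2 by (simp add: power2_eq_square algebra_simps)
    have "(cmod (y - d) + cmod (y + d))\<^sup>2 \<le> (2 * L)\<^sup>2"
      by (intro power_mono foci) simp
    then have "cmod (y - d) * cmod (y + d) \<le> 2 * L\<^sup>2 - A"
      using A by (simp add: power2_sum power_mult_distrib)
    then have "(cmod (y - d) * cmod (y + d))\<^sup>2 \<le> (2 * L\<^sup>2 - A)\<^sup>2"
      by (intro power_mono) auto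
    moreover have "(cmod (y - d) * cmod (y + d))\<^sup>2 = A\<^sup>2 - 4 * r\<^sup>2"
    proof -
      have "(cmod (y - d))\<^sup>2 = A - 2 * r" "(cmod (y + d))\<^sup>2 = A + 2 * r"
        unfolding A_def r_def cmod_power2 by (simp_all add: power2_eq_square algebra_simps)
      then show ?thesis unfolding power_mult_distrib by algebra
    qed
    ultimately have "L\<^sup>2 * (A - L\<^sup>2) \<le> r\<^sup>2" by (simp add: power2_eq_square algebra_simps)
    then show ?thesis by (simp add: A_def L2)
  qed
  \<comment> \<open>The vertex of the parabola \<open>h\<close>. If L = 0, division by zero makes it
    0; then \<open>d\<close>, \<open>c\<close> and \<open>y\<close> vanish and \<open>h\<close> is
    identically 0.\<close>
  define x0 where "x0 = r / L\<^sup>2"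
  have x0: "-1 \<le> x0" "x0 \<le> 1"
    using r_le by (cases "L = 0"; simp add: x0_def divide_simps abs_le_iff)+
  have "h x0 \<le> 0"
  proof (cases "L = 0")
    case True
    then show ?thesis using y_le by (simp add: h x0_def)
  next
    case False
    then have "L\<^sup>2 * h x0 = L\<^sup>2 * ((cmod y)\<^sup>2 - (cmod c)\<^sup>2) - r\<^sup>2"
      by (simp add: h x0_def field_simps power2_eq_square)
    also have "\<dots> \<le> 0" using disc by simp
    finally show ?thesis using False by (simp add: mult_le_0_iff)
  qed
  moreover have "0 \<le> h 1" by (simp add: h_def)
  moreover have "continuous_on {x0..1} h" unfolding h_def[abs_def] by (intro continuous_intros)
  ultimately obtain x where x: "x0 \<le> x" "x \<le> 1" "h x = 0"
    using IVT'[of h x0 0 1] x0 by auto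
  with x0 have x1: "-1 \<le> x" by simp
  \<comment> \<open>If c = 0, then h x = 0 already says \<open>y = x * d\<close>, and any
    \<open>e\<close> of the right modulus will do.\<close>
  define e where "e = (if c = 0 then of_real (sqrt (1 - x\<^sup>2)) else (y - of_real x * d) / c)"
  have sq: "x\<^sup>2 \<le> 1" using x(2) x1 by (simp add: abs_square_le_1)
  have e: "(cmod e)\<^sup>2 = 1 - x\<^sup>2" "c * e = y - of_real x * d"
    using x(3) sq by (auto simp: e_def h_def norm_divide power_divide)
  define s where "s = sqrt ((1 + x) / 2)"
  have s2: "s\<^sup>2 = (1 + x) / 2" using x1 by (simp add: s_def)
  \<comment> \<open>A common phase of \<open>s\<close> and \<open>t\<close> is irrelevant, so
    \<open>s\<close> is real and \<open>t\<close> is solved from \<open>s * cnj t = e / 2\<close>.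
    At x = -1 both \<open>s\<close> and \<open>e\<close> vanish, and any \<open>t\<close> of modulus
    1 works.\<close>
  define t where "t = (if x = -1 then 1 else cnj e / of_real (2 * s))"
  have t2: "(cmod t)\<^sup>2 = (1 - x) / 2"
  proof (cases "x = -1")
    case False
    then have "1 + x > 0" using x1 by simp
    have "(cmod t)\<^sup>2 = (1 - x\<^sup>2) / (4 * s\<^sup>2)"
      using e(1) False by (simp add: t_def norm_divide power_divide norm_mult power_mult_distrib)
    also have "\<dots> = (1 - x) / 2" unfolding s2 using \<open>1 + x > 0\<close> by (simp add: field_simps power2_eq_square)
    finally show ?thesis .
  qed (simp add: t_def)
  have st: "of_real s * cnj t = e / 2"
  proof (cases "x = -1")
    case True
    then show ?thesis using e(1) by (simp add: s_def)
  next
    case False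
    then have "s \<noteq> 0" using x1 by (simp add: s_def)
    then show ?thesis using False by (simp add: t_def)
  qed
  show ?thesis
  proof
    show "(cmod (of_real s))\<^sup>2 + (cmod t)\<^sup>2 = 1" by (simp add: s2 t2 field_simps)
    have "u * (of_real ((1 + x) / 2)) + v * (of_real ((1 - x) / 2)) + c * e / 2 = w"
      unfolding e(2) by (simp add: y_def d_def field_simps)
    moreover have s_sq: "(cmod (of_real s))\<^sup>2 = (1 + x) / 2" by (simp add: s2)
    ultimately show "w = u * (of_real (cmod (of_real s)))\<^sup>2 + v * (of_real (cmod t))\<^sup>2 + c * of_real s * cnj t"
      unfolding mult.assoc st of_real_power[symmetric] t2 s_sq by simp
  qed
qed

subsection \<open>The compression of the weighted composition operator\<close>

lemma powser_sums_shift: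
  fixes z :: complex
  assumes "(\<lambda>j. d j * z ^ j) sums s"
  shows "(\<lambda>j. (if j < k then 0 else d (j - k)) * z ^ j) sums (z ^ k * s)"
  using sums_mult[OF assms, of "z ^ k"]
  by (subst sums_zero_iff_shift[of k, symmetric]) (simp_all add: power_add mult_ac)

text \<open>Orthonormality of the normalised monomials: \<open>f\<close> is a polynomial with known
  coefficients \<open>c\<close>, so the coefficient formula can be applied to \<open>f\<close>
  paired with itself.\<close>

lemma fock_inner_two_monomials_self:
  fixes s t :: complex
  assumes "k \<noteq> l"
  defines "f \<equiv> \<lambda>z. s / of_real (sqrt (fact k)) * z ^ k + t / of_real (sqrt (fact l)) * z ^ l"
  shows "fock_inner f f = of_real ((cmod s)\<^sup>2 + (cmod t)\<^sup>2)"
proof -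
  define c where "c j = (if j = k then s / of_real (sqrt (fact k)) else 0)
     + (if j = l then t / of_real (sqrt (fact l)) else 0)" for j
  have sq: "of_real (sqrt (fact j)) * of_real (sqrt (fact j)) = (fact j :: complex)" for j
    by (simp flip: of_real_mult)
  have "f \<in> fock_space"
    unfolding f_def by (intro fock_space_add fock_space_monomial)
  moreover have "(\<lambda>j. c j * z ^ j) sums f z" for z
  proof -
    have "(\<lambda>j. c j * z ^ j) = (\<lambda>j. (if j = k then s / of_real (sqrt (fact k)) * z ^ j else 0)
        + (if j = l then t / of_real (sqrt (fact l)) * z ^ j else 0))"
      by (auto simp: c_def fun_eq_iff ring_distribs)
    also have "\<dots> sums f z"
      unfolding f_def by (intro sums_add sums_single)
    finally show ?thesis .
  qed
  ultimately have "fock_inner f f = cnj (s / of_real (sqrt (fact k))) * (c k * fact k)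
      + cnj (t / of_real (sqrt (fact l))) * (c l * fact l)"
    unfolding f_def by (rule fock_inner_two_monomials)
  also have "\<dots> = s * cnj s + t * cnj t"
    using assms(1) by (simp add: c_def field_simps flip: sq)
  finally show ?thesis unfolding complex_norm_square[symmetric] by simp
qed

text \<open>The foci carry the factor \<open>\<psi> p\<close> because the diagonal entries of the
  compression are \<open>q 0 * a ^ n\<close> and \<open>q 0 * a ^ (n + m)\<close>, with
  \<open>q 0 = \<psi> p\<close>. Bare powers of \<open>a\<close> would be wrong: for b = 0 and
  constant \<open>\<psi>\<close> equal to 1/2, the numerical range stays within modulus 1/2 and
  misses a ^ 0 = 1.\<close>

theorem proposition2p1:
  fixes \<psi> \<phi> q :: "complex \<Rightarrow> complex" and a b p :: complex
    and qhat :: "nat \<Rightarrow> complex" and n m :: nat and major minor :: real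
  assumes "\<psi> holomorphic_on UNIV"
    and "\<phi> = (\<lambda>z. a * z + b)"
    and "0 < cmod a" and "cmod a < 1"
    and "fock_bounded (weighted_comp \<psi> \<phi>)"
    and "p = b / (1 - a)"
    and "\<psi> p \<noteq> 0"
    and "q = (\<lambda>z. exp (cnj p * (a - 1) * z) * \<psi> (z + p))"
    and "\<And>z. (\<lambda>j. qhat j * (z ^ j / complex_of_real (sqrt (fact j)))) sums q z"
    and "m \<ge> 1"
    and "major = sqrt ((cmod (\<psi> p * a ^ n - \<psi> p * a ^ (n + m)))\<^sup>2
           + (cmod (qhat m * a ^ n * complex_of_real (sqrt (fact (m + n)))))\<^sup>2 / (fact m * fact n))"
    and "minor = cmod (qhat m * a ^ n) * sqrt (fact (m + n)) / sqrt (fact m * fact n)"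
  shows "q \<in> fock_space \<and>
    minor_axis (\<psi> p * a ^ n) (\<psi> p * a ^ (n + m)) major = minor \<and>
    elliptical_disc (\<psi> p * a ^ n) (\<psi> p * a ^ (n + m)) major
      \<subseteq> fock_numerical_range (weighted_comp \<psi> \<phi>)"
proof -
  define T where "T = weighted_comp \<psi> \<phi>"
  define S where "S f = (\<lambda>z. q z * f (a * z))" for f :: "complex \<Rightarrow> complex"
  have "a \<noteq> 1" using assms(4) by auto
  then have b: "b = p * (1 - a)" using assms(6) by simp
  \<comment> \<open>Since \<open>p\<close> is fixed by \<open>\<phi>\<close>, moving
    \<open>p\<close> to the origin turns \<open>\<phi>\<close> into multiplication by
    \<open>a\<close>; the exponential left over is exactly the one in \<open>q\<close>.\<close>
  have TU: "T (fock_shift p f) = fock_shift p (S f)" for f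
  proof
    fix z
    have "cnj p * (a * z + b) - of_real ((cmod p)\<^sup>2 / 2)
        = (cnj p * z - of_real ((cmod p)\<^sup>2 / 2)) + cnj p * (a - 1) * (z - p)"
      unfolding b by (simp add: algebra_simps)
    then have "exp (cnj p * (a * z + b) - of_real ((cmod p)\<^sup>2 / 2))
        = exp (cnj p * z - of_real ((cmod p)\<^sup>2 / 2)) * exp (cnj p * (a - 1) * (z - p))"
      by (simp only: exp_add)
    moreover have "a * z + b - p = a * (z - p)"
      unfolding b by (simp add: algebra_simps)
    ultimately show "T (fock_shift p f) z = fock_shift p (S f) z"
      unfolding T_def weighted_comp_def fock_shift_def S_def assms(2,8) by simp
  qed
  \<comment> \<open>No growth estimate on \<open>q\<close> is made: \<open>T\<close> maps
    \<open>fock_shift p f\<close> into the Fock space, and the inverse Weyl operator carries the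
    result to \<open>S f\<close>.\<close>
  have S_mem: "S f \<in> fock_space" if "f \<in> fock_space" for f
  proof -
    have "fock_shift p (S f) \<in> fock_space"
      using assms(5) fock_shift_in_fock_space[OF that, of p]
      unfolding TU[symmetric] fock_bounded_def T_def by blast
    then show ?thesis
      using fock_shift_in_fock_space[of "fock_shift p (S f)" "- p"] by (simp add: fock_shift_cancel)
  qed
  have "q \<in> fock_space"
    using S_mem[OF fock_space_monomial[of 1 0]] by (simp add: S_def)
  define u where "u = \<psi> p * a ^ n"
  define v where "v = \<psi> p * a ^ (n + m)"
  \<comment> \<open>The entry <S e_n, e_(n+m)>: the coefficient of z^(n+m) in S e_n is
    \<open>a ^ n * qhat m\<close> divided by the roots of n! and m!, and pairing with e_(n+m)
    multiplies it by the root of (n+m)!.\<close>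
  define c where "c = qhat m * a ^ n * of_real (sqrt (fact (m + n)) / sqrt (fact m * fact n))"
  have c: "cmod c = minor"
    unfolding c_def assms(12) norm_mult norm_of_real by (simp add: norm_mult)
  have "(cmod c)\<^sup>2 = (cmod (qhat m * a ^ n * complex_of_real (sqrt (fact (m + n)))))\<^sup>2 / (fact m * fact n)"
    by (simp add: c_def norm_mult norm_divide power_mult_distrib power_divide real_sqrt_mult)
  then have major: "major = sqrt ((cmod (u - v))\<^sup>2 + (cmod c)\<^sup>2)"
    unfolding assms(11) u_def v_def by simp
  have "minor_axis u v major = minor"
    unfolding minor_axis_def major by (simp add: dist_norm flip: c)
  moreover have "elliptical_disc u v major \<subseteq> fock_numerical_range T"
  proof
    fix w assume "w \<in> elliptical_disc u v major"
    then obtain s t where st: "(cmod s)\<^sup>2 + (cmod t)\<^sup>2 = 1"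
      and w: "w = u * (of_real (cmod s))\<^sup>2 + v * (of_real (cmod t))\<^sup>2 + c * s * cnj t"
      unfolding major by (rule elliptical_disc_parametrization)
    define s' where "s' = s / of_real (sqrt (fact n))"
    define t' where "t' = t / of_real (sqrt (fact (n + m)))"
    define f where "f z = s' * z ^ n + t' * z ^ (n + m)" for z
    have f: "f \<in> fock_space"
      unfolding f_def[abs_def] by (intro fock_space_add fock_space_monomial)
    have ff: "fock_inner f f = 1"
      using fock_inner_two_monomials_self[of n "n + m" s t] assms(10) st
      by (simp add: f_def[abs_def] s'_def t'_def)
    define d where "d j = qhat j / of_real (sqrt (fact j))" for j
    have d: "(\<lambda>j. d j * z ^ j) sums q z" for z
      using assms(9)[of z] by (simp add: d_def)
    have "d 0 = \<psi> p"
      using sums_unique2[OF d[of 0] powser_sums_zero[of d]] by (simp add: assms(8))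
    \<comment> \<open>The Taylor coefficients of \<open>S f\<close>: those of \<open>q\<close> moved
      up by n and by n + m.\<close>
    define g where "g j = s' * a ^ n * (if j < n then 0 else d (j - n))
      + t' * a ^ (n + m) * (if j < n + m then 0 else d (j - (n + m)))" for j
    have "(\<lambda>j. g j * z ^ j) sums S f z" for z
    proof -
      have "(\<lambda>j. s' * a ^ n * ((if j < n then 0 else d (j - n)) * z ^ j)
          + t' * a ^ (n + m) * ((if j < n + m then 0 else d (j - (n + m))) * z ^ j))
          sums (s' * a ^ n * (z ^ n * q z) + t' * a ^ (n + m) * (z ^ (n + m) * q z))"
        by (intro sums_add sums_mult powser_sums_shift d)
      also have "s' * a ^ n * (z ^ n * q z) + t' * a ^ (n + m) * (z ^ (n + m) * q z) = S f z"
        by (simp add: S_def f_def power_mult_distrib algebra_simps)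
      finally show ?thesis
        unfolding g_def distrib_right mult.assoc .
    qed
    then have "fock_inner (S f) f = cnj s' * (g n * fact n) + cnj t' * (g (n + m) * fact (n + m))"
      unfolding f_def[abs_def] using S_mem[OF f, unfolded f_def[abs_def]]
      by (intro fock_inner_two_monomials)
    \<comment> \<open>As m is positive, the second summand of \<open>g\<close> vanishes at n: S
      e_(n+m) has no component along e_n, so the matrix is triangular.\<close>
    moreover have "g n = s' * u"
      using assms(10) \<open>d 0 = \<psi> p\<close> by (simp add: g_def u_def)
    moreover have "g (n + m) = s' * a ^ n * d m + t' * v"
      using \<open>d 0 = \<psi> p\<close> by (simp add: g_def v_def)
    moreover have "cnj s' * (s' * u * fact n) = u * (of_real (cmod s))\<^sup>2"
    proof -
      have "cnj s' * s' * fact n = s * cnj s"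
        unfolding s'_def by (simp add: field_simps flip: of_real_mult)
      then show ?thesis unfolding of_real_power[symmetric] complex_norm_square by (simp add: mult_ac)
    qed
    moreover have "cnj t' * (t' * v * fact (n + m)) = v * (of_real (cmod t))\<^sup>2"
    proof -
      have "cnj t' * t' * fact (n + m) = t * cnj t"
        unfolding t'_def by (simp add: field_simps flip: of_real_mult)
      then show ?thesis unfolding of_real_power[symmetric] complex_norm_square by (simp add: mult_ac)
    qed
    moreover have "cnj t' * (s' * a ^ n * d m * fact (n + m)) = c * s * cnj t"
    proof -
      have "(fact (n + m) :: complex) = of_real (sqrt (fact (n + m))) * of_real (sqrt (fact (n + m)))"
        by (simp flip: of_real_mult)
      then show ?thesis
        unfolding s'_def t'_def d_def c_def
        by (simp add: real_sqrt_mult add.commute[of m n] mult_ac)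
    qed
    ultimately have "fock_inner (S f) f = w"
      unfolding w by (simp add: distrib_left distrib_right)
    then have "fock_inner (T (fock_shift p f)) (fock_shift p f) = w"
      unfolding TU fock_inner_shift[OF S_mem[OF f] f] .
    moreover have "fock_norm (fock_shift p f) = 1"
      unfolding fock_norm_def fock_inner_shift[OF f f] ff by simp
    ultimately show "w \<in> fock_numerical_range T"
      unfolding fock_numerical_range_def using fock_shift_in_fock_space[OF f, of p] by blast
  qed
  ultimately show ?thesis
    using \<open>q \<in> fock_space\<close> by (simp add: u_def v_def T_def)
qed

end
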